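(* Let $G=\mathrm{GL}_2$ and let $$\gamma=\begin{bmatrix}0&b_0\epsilon^n\\ b_0\epsilon^{n+1}&0\end{bmatrix},\qquad b_0\in\mathcal O^\times,\ n\in\mathbf N.$$ For $(a_1,a_2)\in\mathbf Z^2$, $$\mathcal X_\gamma\cap I\begin{pmatrix}\epsilon^{a_1}&\\&\epsilon^{a_2}\end{pmatrix}K/K=\begin{cases}I\begin{pmatrix}\epsilon^{a_1}&\\&\epsilon^{a_2}\end{pmatrix}K/K,&\text{if }-(n+1)\le a_1-a_2\le n,\\ \emptyset,&\text{otherwise.}\end{cases}$$ As a corollary, $$J_G(\gamma)=I_\gamma^G=|F_\gamma(\mathbf F_q)|=\sum_{i=0}^n q^i.$$
   Context: $F=\mathbf F_q((\epsilon))$, $\mathcal O=\mathbf F_q[[\epsilon]]$, $\mathrm{char}(\mathbf F_q)>2$, $K=G(\mathcal O)$, and $I\subset K$ is the standard Iwahori subgroup, the preimage of the upper triangular Borel subgroup under $G(\mathcal O)\to G(\mathbf F_q)$. $\mathfrak g$ is the Lie algebra of $G$. $\mathcal X=G(F)/K$ is the affine Grassmannian and $\mathcal X_\gamma=\{[g]\in\mathcal X:\mathrm{Ad}(g^{-1})\gamma\in\mathfrak g(\mathcal O)\}$ the affine Springer fiber. The centralizer $T$ of $\gamma$ satisfies $T(F)\cong E^\times$ with $E=\mathbf F_q((\epsilon^{1/2}))$; since $\gamma$ is anisotropic modulo the center, the fundamental domain $F_\gamma$ is the connected component $\{[g]\in\mathcal X_\gamma:\mathrm{val}(\det g)=0\}$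 of $\mathcal X_\gamma$. The orbital integral is $$I_\gamma^G=\int_{T(F)\backslash G(F)}\mathbf 1_{\mathfrak g(\mathcal O)}(\mathrm{Ad}(g^{-1})\gamma)\,\frac{dg}{dt}$$ with Haar measures normalized by $\mathrm{vol}(K)=1$ and $\mathrm{vol}(\mathcal O_E^\times)=1$, and $J_G(\gamma)$ is Arthur's weighted orbital integral for the Levi subgroup $G$ itself, i.e. the same integral with weight $\mathrm v_G\equiv1$. *)

theory Defs
  imports
    "HOL-Analysis.Analysis"
    "HOL-Algebra.Left_Coset"
    "HOL-Computational_Algebra.Formal_Laurent_Series"
begin

section \<open>The group and its subgroups\<close>

text \<open>
  The residue field \<open>F\<^sub>q\<close> is a type \<open>'a :: finite_field\<close> with \<open>q = CARD('a)\<close>;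
  \<open>O\<close> is \<open>'a fps\<close>, \<open>F\<close> is \<open>'a fls\<close>, \<open>\<epsilon>\<close> is \<open>fls_X\<close> and \<open>val\<close> is \<open>fls_subdegree\<close>.
  The topology on \<open>F\<close> is the library's \<open>\<epsilon>\<close>-adic one, and \<open>M\<^sub>2(F)\<close> has the product topology.
\<close>

definition mat2 :: "'r::zero \<Rightarrow> 'r \<Rightarrow> 'r \<Rightarrow> 'r \<Rightarrow> 'r^2^2" where
  "mat2 a b c d = vector [vector [a, b], vector [c, d]]"

definition GL2 :: "('r::comm_ring_1^2^2) monoid" where
  "GL2 = \<lparr>carrier = {A. invertible A}, mult = (**), one = mat 1\<rparr>"

definition borel2 :: "('r::comm_ring_1^2^2) set" where
  "borel2 = {A \<in> carrier GL2. A $ 2 $ 1 = 0}"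

definition to_F :: "'a::finite_field fps^2^2 \<Rightarrow> 'a fls^2^2" where
  "to_F A = (\<chi> i j. fps_to_fls (A $ i $ j))"

definition residue_mat :: "'a::finite_field fps^2^2 \<Rightarrow> 'a^2^2" where
  "residue_mat A = (\<chi> i j. fps_nth (A $ i $ j) 0)"

definition K_O :: "('a::finite_field fls^2^2) set" where
  "K_O = to_F ` carrier GL2"

definition iwahori :: "('a::finite_field fls^2^2) set" where
  "iwahori = to_F ` {A \<in> carrier GL2. residue_mat A \<in> borel2}"

definition g_O :: "('a::finite_field fls^2^2) set" where
  "g_O = range to_F"

definition Ad :: "'r::comm_ring_1^2^2 \<Rightarrow> 'r^2^2 \<Rightarrow> 'r^2^2" where
  "Ad g X = g ** X ** matrix_inv g"

definition centralizer :: "'r::comm_ring_1^2^2 \<Rightarrow> ('r^2^2) set" where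
  "centralizer \<gamma> = {g \<in> carrier GL2. g ** \<gamma> = \<gamma> ** g}"


section \<open>Affine Springer fibers\<close>

definition affine_springer_fiber :: "'a::finite_field fls^2^2 \<Rightarrow> ('a fls^2^2) set set" where
  "affine_springer_fiber \<gamma> =
     {g <#\<^bsub>GL2\<^esub> K_O | g. g \<in> carrier GL2 \<and> Ad (matrix_inv g) \<gamma> \<in> g_O}"

definition iwahori_orbit :: "int \<Rightarrow> int \<Rightarrow> ('a::finite_field fls^2^2) set set" where
  "iwahori_orbit a\<^sub>1 a\<^sub>2 =
     {(k ** mat2 (fls_X powi a\<^sub>1) 0 0 (fls_X powi a\<^sub>2)) <#\<^bsub>GL2\<^esub> K_O | k. k \<in> iwahori}"

text \<open>
  The set of \<open>F\<^sub>q\<close>-points of the fundamental domain, for \<open>\<gamma>\<close> anisotropic modulo the center.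
\<close>

definition fundamental_domain :: "'a::finite_field fls^2^2 \<Rightarrow> ('a fls^2^2) set set" where
  "fundamental_domain \<gamma> =
     {g <#\<^bsub>GL2\<^esub> K_O | g. g \<in> carrier GL2 \<and> Ad (matrix_inv g) \<gamma> \<in> g_O \<and>
        fls_subdegree (det g) = 0}"


section \<open>Invariant measures\<close>

definition is_haar_measure :: "('g::topological_space) monoid \<Rightarrow> 'g measure \<Rightarrow> bool" where
  "is_haar_measure G M \<longleftrightarrow>
     sets M = sets (restrict_space borel (carrier G)) \<and>
     (\<forall>C. compact C \<and> C \<subseteq> carrier G \<longrightarrow> emeasure M C < \<infinity>) \<and>
     emeasure M (carrier G) \<noteq> 0 \<and>
     (\<forall>g\<in>carrier G. \<forall>A\<in>sets M. emeasure M (g <#\<^bsub>G\<^esub> A) = emeasure M A)"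

text \<open>
  The measure \<open>dg/dt\<close> on \<open>T \ G\<close>: a measure on the Borel sets of the quotient topology
  for which Weil's integration formula holds.  A function on \<open>G\<close> that is constant on the
  cosets \<open>Tg\<close> is regarded as a function on \<open>T \ G\<close> by taking the unique element of its image.
\<close>

definition quotient_fun :: "('g \<Rightarrow> 'b) \<Rightarrow> 'g set \<Rightarrow> 'b" where
  "quotient_fun \<phi> c = the_elem (\<phi> ` c)"

definition is_quotient_measure ::
  "('g::topological_space) monoid \<Rightarrow> 'g set \<Rightarrow> 'g measure \<Rightarrow> 'g measure \<Rightarrow> 'g set measure \<Rightarrow> bool"
where
  "is_quotient_measure G T dg dt M \<longleftrightarrow>
     sets M = sets (sigma (rcosets\<^bsub>G\<^esub> T)
       {U. U \<subseteq> rcosets\<^bsub>G\<^esub> T \<and> openin (top_of_set (carrier G)) (\<Union>U)}) \<and>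
     (\<forall>f \<in> borel_measurable dg. (\<integral>\<^sup>+ g. f g \<partial>dg) =
        (\<integral>\<^sup>+ c. quotient_fun (\<lambda>g. \<integral>\<^sup>+ t. f (t \<otimes>\<^bsub>G\<^esub> g) \<partial>dt) c \<partial>M))"


section \<open>Orbital integrals\<close>

text \<open>
  \<open>E = F\<^sub>q((\<epsilon>\<^bsup>1/2\<^esup>))\<close> is again modelled by \<open>'a fls\<close>, with \<open>fls_X\<close> now in the role of
  \<open>\<epsilon>\<^bsup>1/2\<^esup>\<close>, so that \<open>F\<close> embeds into \<open>E\<close> by substituting \<open>fls_X\<^sup>2\<close> for \<open>fls_X\<close>.
  \<open>E_mat x y\<close> is the matrix of multiplication by \<open>x + y \<epsilon>\<^bsup>1/2\<^esup>\<close> on \<open>E\<close> with respect to the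
  \<open>F\<close>-basis \<open>\<epsilon>\<^bsup>1/2\<^esup>, 1\<close>.
\<close>

definition E_elt :: "'a::finite_field fls \<Rightarrow> 'a fls \<Rightarrow> 'a fls" where
  "E_elt x y = fls_compose_power x 2 + fls_compose_power y 2 * fls_X"

definition E_mat :: "'a::finite_field fls \<Rightarrow> 'a fls \<Rightarrow> 'a fls^2^2" where
  "E_mat x y = mat2 x y (fls_X * y) x"

text \<open>
  Every element of \<open>E\<close> is uniquely \<open>E_elt x y\<close>, and \<open>E_elt x y \<mapsto> E_mat x y\<close> is an isomorphism of
  \<open>E\<^sup>\<times>\<close> with the centralizer of \<open>mat2 0 u (\<epsilon> u) 0\<close>, \<open>u \<noteq> 0\<close>; it carries \<open>O\<^sub>E\<^sup>\<times>\<close> to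
  \<open>O_E_units\<close>.
\<close>

lemma mat2_nth [simp]:
  "mat2 a b c d $ 1 $ 1 = a" "mat2 a b c d $ 1 $ 2 = b"
  "mat2 a b c d $ 2 $ 1 = c" "mat2 a b c d $ 2 $ 2 = d"
  by (simp_all add: mat2_def)

lemma mat2_mult:
  fixes a :: "'r::comm_ring_1"
  shows "mat2 a b c d ** mat2 a' b' c' d' =
    mat2 (a * a' + b * c') (a * b' + b * d') (c * a' + d * c') (c * b' + d * d')"
  by (simp add: vec_eq_iff matrix_matrix_mult_def sum_2 forall_2)

lemma mat2_eq: "A = mat2 (A $ 1 $ 1) (A $ 1 $ 2) (A $ 2 $ 1) (A $ 2 $ 2)"
  by (simp add: vec_eq_iff forall_2)

lemma E_mat_mult: "E_mat x y ** E_mat x' y' = E_mat (x * x' + fls_X * y * y') (x * y' + y * x')"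
  by (simp add: E_mat_def mat2_mult algebra_simps)

lemma E_elt_mult: "E_elt x y * E_elt x' y' = E_elt (x * x' + fls_X * y * y') (x * y' + y * x')"
proof -
  have X: "fls_X_intpow 2 = (fls_X * fls_X :: 'a fls)"
    by (metis fls_X_power_conv_shift_1 fls_X_intpow_power power2_eq_square of_nat_numeral)
  show ?thesis by (simp add: E_elt_def algebra_simps X)
qed

lemma E_elt_inject: "E_elt x y = E_elt x' y' \<Longrightarrow> x = x' \<and> y = y'"
proof -
  assume h: "E_elt x y = E_elt x' y'"
  have e: "fls_nth (E_elt x y) (2*k) = fls_nth x k" "fls_nth (E_elt x y) (2*k+1) = fls_nth y k" for k and x y :: "'a fls"
    by (auto simp: E_elt_def fls_nth_compose_power fls_times_both_shifted_simp fls_X_times_conv_shift)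
  show ?thesis using e h by (metis fls_eqI)
qed

lemma E_elt_surj: "\<exists>x y. E_elt x y = (e::'a::finite_field fls)"
proof -
  let ?x = "Abs_fls (\<lambda>k. fls_nth e (2*k))"
  let ?y = "Abs_fls (\<lambda>k. fls_nth e (2*k+1))"
  define N where "N = \<bar>fls_subdegree e\<bar>+1"
  have 1: "fls_nth ?x = (\<lambda>k. fls_nth e (2*k))"
    by (rule ext, rule nth_Abs_fls_ex_lower_bound, rule exI[of _ "-N"]) (auto simp: N_def intro!: fls_eq0_below_subdegree)
  have 2: "fls_nth ?y = (\<lambda>k. fls_nth e (2*k+1))"
    by (rule ext, rule nth_Abs_fls_ex_lower_bound, rule exI[of _ "-N"]) (auto simp: N_def intro!: fls_eq0_below_subdegree)
  have "fls_nth (E_elt ?x ?y) m = fls_nth e m" for m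
  proof (cases "even m")
    case True
    then obtain k where "m = 2 * k" by (elim evenE)
    then show ?thesis
      by (simp add: E_elt_def fls_nth_compose_power fls_X_times_conv_shift 1)
  next
    case False
    then obtain k where "m = 2 * k + 1" by (elim oddE)
    then show ?thesis
      by (simp add: E_elt_def fls_nth_compose_power fls_X_times_conv_shift 2)
  qed
  then have "E_elt ?x ?y = e" by (rule fls_eqI)
  thus ?thesis by blast
qed

lemma centralizer_eq_E_mat:
  fixes u :: "'a::finite_field fls"
  assumes "u \<noteq> 0"
  shows "centralizer (mat2 0 u (fls_X * u) 0) = {E_mat x y | x y. E_elt x y \<noteq> 0}"
proof -
  have z: "E_elt 0 0 = (0::'a fls)" by (simp add: E_elt_def)
  have c: "A ** mat2 0 u (fls_X * u) 0 = mat2 0 u (fls_X * u) 0 ** A \<longleftrightarrow> A = E_mat (A$1$1) (A$1$2)" for A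
    using assms apply (subst (1 2) mat2_eq[of A])
    apply (subst mat2_mult)+
    by (auto simp: E_mat_def vec_eq_iff forall_2)
  have i: "invertible (E_mat x y) \<longleftrightarrow> E_elt x y \<noteq> 0" for x y :: "'a fls"
  proof
    assume "invertible (E_mat x y)"
    then obtain B where "E_mat x y ** B = mat 1" by (auto simp: invertible_def)
    hence "(E_mat x y ** B) $ 1 $ 1 = 1" by (simp add: mat_def)
    hence "E_mat x y $ 1 $ 1 \<noteq> 0 \<or> E_mat x y $ 1 $ 2 \<noteq> 0" by (auto simp: matrix_matrix_mult_def sum_2)
    hence "(x,y) \<noteq> (0,0)" by (auto simp: E_mat_def vec_eq_iff forall_2)
    thus "E_elt x y \<noteq> 0" using E_elt_inject[of x y 0 0] z by auto
  next
    assume n: "E_elt x y \<noteq> 0"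
    obtain x' y' where "E_elt x' y' = inverse (E_elt x y)" using E_elt_surj by metis
    hence "E_elt x y * E_elt x' y' = E_elt 1 0" using n by (simp add: E_elt_def)
    hence "x * x' + fls_X * y * y' = 1 \<and> x * y' + y * x' = 0"
      unfolding E_elt_mult by (rule E_elt_inject)
    hence "E_mat x y ** E_mat x' y' = mat 1"
      unfolding E_mat_mult by (simp add: E_mat_def vec_eq_iff forall_2 mat_def)
    moreover have "E_mat x y ** E_mat x' y' = E_mat x' y' ** E_mat x y" by (simp add: E_mat_mult algebra_simps)
    ultimately show "invertible (E_mat x y)" unfolding invertible_def by metis
  qed
  show ?thesis
  proof (rule Set.set_eqI, rule iffI)
    fix A assume "A \<in> centralizer (mat2 0 u (fls_X * u) 0)"
    hence "invertible A" "A = E_mat (A$1$1) (A$1$2)" by (auto simp: centralizer_def GL2_def c)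
    with i show "A \<in> {E_mat x y | x y. E_elt x y \<noteq> 0}" by (metis (mono_tags, lifting) mem_Collect_eq)
  next
    fix A :: "'a fls^2^2" assume "A \<in> {E_mat x y | x y. E_elt x y \<noteq> 0}"
    then obtain x y where xy: "A = E_mat x y" "E_elt x y \<noteq> 0" by blast
    hence "A = E_mat (A$1$1) (A$1$2)" by (simp add: E_mat_def)
    with xy i show "A \<in> centralizer (mat2 0 u (fls_X * u) 0)"
      by (simp only: centralizer_def GL2_def c mem_Collect_eq partial_object.simps) blast
  qed
qed

definition O_E_units :: "('a::finite_field fls^2^2) set" where
  "O_E_units = {E_mat x y | x y. E_elt x y \<in> fps_to_fls ` {u. u dvd 1}}"

definition orbital_integral :: "('a::finite_field fls^2^2) set measure \<Rightarrow> 'a fls^2^2 \<Rightarrow> real" where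
  "orbital_integral M \<gamma> =
     (\<integral>c. quotient_fun (\<lambda>g. indicator g_O (Ad (matrix_inv g) \<gamma>)) c \<partial>M)"

definition weighted_orbital_integral ::
  "('a::finite_field fls^2^2 \<Rightarrow> real) \<Rightarrow> ('a fls^2^2) set measure \<Rightarrow> 'a fls^2^2 \<Rightarrow> real" where
  "weighted_orbital_integral v M \<gamma> =
     (\<integral>c. quotient_fun (\<lambda>g. indicator g_O (Ad (matrix_inv g) \<gamma>) * v g) c \<partial>M)"

definition weight_G :: "'a::finite_field fls^2^2 \<Rightarrow> real" where
  "weight_G g = 1"

abbreviation J_G :: "('a::finite_field fls^2^2) set measure \<Rightarrow> 'a fls^2^2 \<Rightarrow> real" where
  "J_G \<equiv> weighted_orbital_integral weight_G"

definition normalized_measures ::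
  "'a::finite_field fls^2^2 \<Rightarrow> ('a fls^2^2) measure \<Rightarrow> ('a fls^2^2) measure \<Rightarrow>
   ('a fls^2^2) set measure \<Rightarrow> bool" where
  "normalized_measures \<gamma> dg dt M \<longleftrightarrow>
     is_haar_measure GL2 dg \<and> emeasure dg K_O = 1 \<and>
     is_haar_measure (GL2\<lparr>carrier := centralizer \<gamma>\<rparr>) dt \<and> emeasure dt O_E_units = 1 \<and>
     is_quotient_measure GL2 (centralizer \<gamma>) dg dt M"

end

theory Submission
  imports Defs
begin

text \<open>
  Since \<open>val \<epsilon>\<close> is odd, \<open>val (x\<^sup>2 - \<epsilon> y\<^sup>2)\<close> is the minimum of \<open>2 val x\<close> and \<open>2 val y + 1\<close>.
  The off-diagonal entries of \<open>Ad (g\<^sup>-\<^sup>1) \<gamma>\<close> are such norm forms in the columns of \<open>g\<close>, up to a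
  factor of known valuation, and if they are integral then so are the diagonal entries.
  Membership in the fiber thus amounts to one lower bound on the valuation of each entry of \<open>g\<close>.
  In an Iwahori orbit these bounds restrict only \<open>a\<^sub>1 - a\<^sub>2\<close>.  In the Hermite normal form
  \<open>[\<epsilon>\<^sup>a, x; 0, \<epsilon>\<^sup>-\<^sup>a]\<close>, \<open>x \<in> F / \<epsilon>\<^sup>a O\<close>, they say \<open>-N \<le> a \<le> n div 2\<close> and \<open>val x \<ge> -N\<close>
  with \<open>N = (n + 1) div 2\<close>, which leaves \<open>q ^ (a + N)\<close> points for each \<open>a\<close>, and \<open>a + N\<close> runs
  through \<open>0, \<dots>, n\<close>.  For the orbital integral, Weil's formula is applied to the
  indicator function of the elements \<open>g\<close> of the fiber with \<open>val (det g) = 0\<close>: every coset \<open>Tg\<close> in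
  the fiber meets them in a translate of \<open>O\<^sub>E\<^sup>\<times>\<close>, and they form \<open>|F\<^sub>\<gamma>(F\<^sub>q)|\<close> cosets of \<open>K\<close>.
\<close>

no_notation fps_nth (infixl "$" 75)


section \<open>Valuations and integral matrices\<close>

definition val_ge :: "int \<Rightarrow> 'a::zero fls \<Rightarrow> bool" where
  "val_ge m x \<longleftrightarrow> x = 0 \<or> m \<le> fls_subdegree x"

lemma val_ge_iff_nth: "val_ge m x \<longleftrightarrow> (\<forall>k<m. fls_nth x k = 0)"
  unfolding val_ge_def by (metis fls_eq0_below_subdegree fls_subdegree_geI fls_zero_nth order_less_le_trans)

lemma val_ge_0 [simp]: "val_ge m 0"
  by (simp add: val_ge_def)

lemma val_ge_mono: "val_ge m x \<Longrightarrow> k \<le> m \<Longrightarrow> val_ge k x"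
  by (auto simp: val_ge_def)

lemma val_ge_add: "val_ge m x \<Longrightarrow> val_ge m y \<Longrightarrow> val_ge m (x + y)"
  for x y :: "'a::monoid_add fls"
  by (simp add: val_ge_iff_nth)

lemma val_ge_diff: "val_ge m x \<Longrightarrow> val_ge m y \<Longrightarrow> val_ge m (x - y)"
  for x y :: "'a::group_add fls"
  by (simp add: val_ge_iff_nth)

lemma val_ge_uminus [simp]: "val_ge m (- x) \<longleftrightarrow> val_ge m x"
  for x :: "'a::group_add fls"
  by (simp add: val_ge_iff_nth)

lemma val_ge_mult: "val_ge m x \<Longrightarrow> val_ge k y \<Longrightarrow> val_ge (m + k) (x * y)"
  for x y :: "'a::idom fls"
  by (cases "x = 0"; cases "y = 0"; simp add: val_ge_def)

lemma val_ge_0_mult: "val_ge 0 x \<Longrightarrow> val_ge 0 y \<Longrightarrow> val_ge 0 (x * y)"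
  for x y :: "'a::idom fls"
  using val_ge_mult[of 0 x 0 y] by simp

lemma val_ge_mult_cancel: "y \<noteq> 0 \<Longrightarrow> val_ge m (y * x) \<longleftrightarrow> val_ge (m - fls_subdegree y) x"
  for x y :: "'a::idom fls"
  by (cases "x = 0"; simp add: val_ge_def; linarith)

lemma val_ge_divide: "y \<noteq> 0 \<Longrightarrow> val_ge m (x / y) \<longleftrightarrow> val_ge (m + fls_subdegree y) x"
  for x y :: "'a::field fls"
  using val_ge_mult_cancel[of y "m + fls_subdegree y" "x / y"] by simp

section \<open>The norm form of \<open>E\<close> over \<open>F\<close>\<close>

lemma norm_form_nonzero_subdegree:
  fixes x y :: "'a::field fls"
  assumes "x \<noteq> 0" "y \<noteq> 0"
  shows "x * x - fls_X * y * y \<noteq> 0"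
    and "fls_subdegree (x * x - fls_X * y * y) = min (2 * fls_subdegree x) (2 * fls_subdegree y + 1)"
proof -
  have s: "fls_subdegree (x * x) = 2 * fls_subdegree x"
    "fls_subdegree (fls_X * y * y) = 2 * fls_subdegree y + 1"
    using assms by simp_all
  \<comment> \<open>One valuation is even and the other odd, so the leading terms cannot
    cancel.\<close>
  then have ne: "fls_subdegree (x * x) \<noteq> fls_subdegree (fls_X * y * y)"
    by presburger
  then show "x * x - fls_X * y * y \<noteq> 0"
    by auto
  show "fls_subdegree (x * x - fls_X * y * y) = min (2 * fls_subdegree x) (2 * fls_subdegree y + 1)"
    using fls_subdegree_diff_eq1[of "x * x" "fls_X * y * y"]
      fls_subdegree_diff_eq2[of "fls_X * y * y" "x * x"] ne assms s
    by (cases "fls_subdegree (x * x) < fls_subdegree (fls_X * y * y)") simp_all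
qed

lemma norm_form_eq_0_iff: "x * x - fls_X * y * y = 0 \<longleftrightarrow> x = 0 \<and> y = 0"
  for x y :: "'a::field fls"
  using norm_form_nonzero_subdegree(1)[of x y] by (cases "x = 0"; cases "y = 0"; simp)

text \<open>This separates the variables: bounds on the conjugate of \<gamma> will become bounds on
  single entries of \<open>g\<close>.\<close>

lemma val_ge_norm_form:
  fixes x y :: "'a::field fls"
  shows "val_ge m (x * x - fls_X * y * y) \<longleftrightarrow>
    (x = 0 \<or> m \<le> 2 * fls_subdegree x) \<and> (y = 0 \<or> m \<le> 2 * fls_subdegree y + 1)"
proof (cases "x = 0 \<or> y = 0")
  case True
  then show ?thesis by (cases "x = 0"; cases "y = 0") (simp_all add: val_ge_def)
next
  case False
  then show ?thesis
    using norm_form_nonzero_subdegree[of x y] by (auto simp: val_ge_def)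
qed

lemma fls_nth_E_elt:
  "fls_nth (E_elt x y) (2 * k) = fls_nth x k"
  "fls_nth (E_elt x y) (2 * k + 1) = fls_nth y k"
  by (auto simp: E_elt_def fls_nth_compose_power fls_times_both_shifted_simp fls_X_times_conv_shift)

lemma E_elt_eq_0_iff: "E_elt x y = 0 \<longleftrightarrow> x = 0 \<and> y = 0"
  using E_elt_inject[of x y 0 0] by (auto simp: E_elt_def)

text \<open>The norm of \<open>E_elt x y\<close> is \<open>x * x - fls_X * y * y\<close>, and the
  norm of a totally ramified extension preserves normalized valuations.\<close>

lemma val_ge_E_elt: "val_ge m (E_elt x y) \<longleftrightarrow> val_ge m (x * x - fls_X * y * y)"
proof -
  \<comment> \<open>\<open>E_elt\<close> interleaves coefficients, those of \<open>x\<close> in even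
    and those of \<open>y\<close> in odd degree, so the bound splits by parity just as it does for
    the norm form.\<close>
  have "val_ge m (E_elt x y) \<longleftrightarrow> (\<forall>k. 2 * k < m \<longrightarrow> fls_nth x k = 0) \<and> (\<forall>k. 2 * k + 1 < m \<longrightarrow> fls_nth y k = 0)"
    unfolding val_ge_iff_nth by (metis fls_nth_E_elt evenE oddE)
  also have "(\<forall>k. 2 * k < m \<longrightarrow> fls_nth x k = 0) \<longleftrightarrow> x = 0 \<or> m \<le> 2 * fls_subdegree x"
    by (smt (verit, del_insts) fls_eq0_below_subdegree nth_fls_subdegree_nonzero fls_zero_nth)
  also have "(\<forall>k. 2 * k + 1 < m \<longrightarrow> fls_nth y k = 0) \<longleftrightarrow> y = 0 \<or> m \<le> 2 * fls_subdegree y + 1"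
    by (smt (verit, del_insts) fls_eq0_below_subdegree nth_fls_subdegree_nonzero fls_zero_nth)
  finally show ?thesis
    by (simp add: val_ge_norm_form)
qed

lemma fls_subdegree_norm_form: "fls_subdegree (x * x - fls_X * y * y) = fls_subdegree (E_elt x y)"
proof (cases "x = 0 \<and> y = 0")
  case False
  \<comment> \<open>Integers with the same lower bounds are equal. Zero is set apart because
    \<open>val_ge\<close> holds there for every \<open>m\<close>.\<close>
  then have "m \<le> fls_subdegree (x * x - fls_X * y * y) \<longleftrightarrow> m \<le> fls_subdegree (E_elt x y)" for m
    using val_ge_E_elt[of m x y] unfolding val_ge_def norm_form_eq_0_iff E_elt_eq_0_iff by blast
  then show ?thesis
    by (metis order_antisym order_refl)
qed (simp add: E_elt_def)

section \<open>The group and its integral subgroups\<close>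

lemma matrix_inv_inverse:
  assumes "invertible A"
  shows "A ** matrix_inv A = mat 1" "matrix_inv A ** A = mat 1"
  using assms unfolding invertible_def matrix_inv_def by (metis (mono_tags, lifting) someI_ex)+

lemma carrier_GL2 [simp]: "A \<in> carrier GL2 \<longleftrightarrow> invertible A"
  by (simp add: GL2_def)

lemma mult_GL2 [simp]: "A \<otimes>\<^bsub>GL2\<^esub> B = A ** B"
  by (simp add: GL2_def)

lemma one_GL2 [simp]: "\<one>\<^bsub>GL2\<^esub> = mat 1"
  by (simp add: GL2_def)

lemma group_GL2: "group (GL2 :: ('r::comm_ring_1^2^2) monoid)"
proof (rule groupI)
  fix A :: "'r^2^2"
  assume "A \<in> carrier GL2"
  then obtain B where "A ** B = mat 1" "B ** A = mat 1"
    by (auto simp: invertible_def)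
  then have "B \<in> carrier GL2" "B \<otimes>\<^bsub>GL2\<^esub> A = \<one>\<^bsub>GL2\<^esub>"
    by (auto simp: invertible_def)
  then show "\<exists>B\<in>carrier GL2. B \<otimes>\<^bsub>GL2\<^esub> A = \<one>\<^bsub>GL2\<^esub>"
    by (rule rev_bexI)
next
  show "\<one>\<^bsub>GL2\<^esub> \<in> carrier (GL2 :: ('r^2^2) monoid)"
    unfolding carrier_GL2 one_GL2 invertible_def by (metis matrix_mul_lid)
qed (simp_all add: invertible_mult matrix_mul_assoc)

interpretation GL2: group "GL2 :: ('r::comm_ring_1^2^2) monoid"
  by (rule group_GL2)

lemma inv_GL2: "invertible A \<Longrightarrow> inv\<^bsub>GL2\<^esub> A = matrix_inv A"
  for A :: "'r::comm_ring_1^2^2"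
  using GL2.inv_equality[of "matrix_inv A" A]
  by (metis carrier_GL2 invertible_def matrix_inv_inverse mult_GL2 one_GL2)

text \<open>Stated over any commutative ring because \<open>K_O\<close> comes from matrices
  invertible over the power series ring.\<close>

lemma invertible_mat2_iff: "invertible A \<longleftrightarrow> det A dvd 1"
  for A :: "'r::comm_ring_1^2^2"
proof
  assume "invertible A"
  then show "det A dvd 1"
    by (metis det_I det_mul dvdI matrix_inv_inverse(1))
next
  assume "det A dvd 1"
  then obtain e where e: "1 = det A * e" ..
  \<comment> \<open>The adjugate of \<open>A\<close>, scaled by the inverse \<open>e\<close> of the
    determinant.\<close>
  define B where "B = mat2 (e * A $ 2 $ 2) (- e * A $ 1 $ 2) (- e * A $ 2 $ 1) (e * A $ 1 $ 1)"
  have "A ** B = mat 1" "B ** A = mat 1"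
    using e by (simp_all add: B_def vec_eq_iff forall_2 matrix_matrix_mult_def sum_2 mat_def det_2 algebra_simps)
  then show "invertible A"
    unfolding invertible_def by blast
qed

lemma to_F_mult: "to_F (A ** B) = to_F A ** to_F B"
  by (simp add: to_F_def vec_eq_iff forall_2 matrix_matrix_mult_def sum_2 fls_times_fps_to_fls)

lemma to_F_1 [simp]: "to_F (mat 1) = mat 1"
  by (simp add: to_F_def vec_eq_iff forall_2 mat_def)

lemma det_to_F: "det (to_F A) = fps_to_fls (det A)"
  by (simp add: to_F_def det_2 fls_times_fps_to_fls)

lemma fps_to_fls_regpart: "val_ge 0 x \<Longrightarrow> fps_to_fls (fls_regpart x) = x"
  by (auto simp: val_ge_def)

lemma val_ge_0_fps_to_fls [simp]: "val_ge 0 (fps_to_fls f)"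
  by (simp add: val_ge_def fls_subdegree_fls_to_fps_gt0)

lemma g_O_iff: "A \<in> g_O \<longleftrightarrow> (\<forall>i j. val_ge 0 (A $ i $ j))"
proof
  assume "\<forall>i j. val_ge 0 (A $ i $ j)"
  then have "A = to_F (\<chi> i j. fls_regpart (A $ i $ j))"
    by (simp add: to_F_def vec_eq_iff fps_to_fls_regpart)
  then show "A \<in> g_O"
    unfolding g_O_def by blast
qed (auto simp: g_O_def to_F_def)

lemma g_O_mult: "A \<in> g_O \<Longrightarrow> B \<in> g_O \<Longrightarrow> A ** B \<in> g_O"
  unfolding g_O_def by (auto simp flip: to_F_mult)

lemma fps_to_fls_unit_iff: "f dvd 1 \<longleftrightarrow> fps_to_fls f \<noteq> 0 \<and> fls_subdegree (fps_to_fls f) = 0"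
  for f :: "'a::field fps"
  by (auto simp: fls_subdegree_fls_to_fps subdegree_eq_0_iff)

text \<open>This lets membership be tested by valuations in \<open>F\<close>, without returning to
  power series matrices.\<close>

lemma K_O_iff: "A \<in> K_O \<longleftrightarrow> A \<in> g_O \<and> det A \<noteq> 0 \<and> fls_subdegree (det A) = 0"
  unfolding K_O_def g_O_def
  by (auto simp: invertible_mat2_iff det_to_F fps_to_fls_unit_iff simp del: fps_is_unit_iff fps_to_fls_eq_0_iff)

lemma K_O_invertible: "A \<in> K_O \<Longrightarrow> invertible A"
  by (simp add: K_O_iff invertible_det_nz)

lemma K_O_matrix_inv: "A \<in> K_O \<Longrightarrow> matrix_inv A \<in> K_O"
proof -
  assume "A \<in> K_O"
  then obtain B where B: "A = to_F B" "invertible B"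
    by (auto simp: K_O_def)
  then have "to_F (matrix_inv B) ** A = mat 1" "A ** to_F (matrix_inv B) = mat 1"
    by (simp_all flip: to_F_mult add: matrix_inv_inverse)
  then have "matrix_inv A = to_F (matrix_inv B)"
    by (metis invertible_def matrix_inv_inverse(1) matrix_mul_assoc matrix_mul_lid matrix_mul_rid)
  moreover have "invertible (matrix_inv B)"
    using B(2) by (metis invertible_def matrix_inv_inverse)
  ultimately show ?thesis
    by (simp add: K_O_def)
qed

lemma K_O_mult: "A \<in> K_O \<Longrightarrow> B \<in> K_O \<Longrightarrow> A ** B \<in> K_O"
  by (simp add: K_O_iff g_O_mult det_mul)

lemma subgroup_K_O: "subgroup K_O GL2"
proof (rule GL2.subgroupI)
  have "to_F (mat 1) \<in> K_O"
    unfolding K_O_def using GL2.one_closed by (intro imageI) simp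
  then show "K_O \<noteq> {}" by blast
qed (auto simp: K_O_invertible inv_GL2 K_O_matrix_inv K_O_mult)

lemma iwahoriD:
  assumes "A \<in> iwahori"
  shows "A \<in> K_O" "val_ge 1 (A $ 2 $ 1)" "A $ 1 $ 1 \<noteq> 0" "fls_subdegree (A $ 1 $ 1) = 0"
    "A $ 2 $ 2 \<noteq> 0" "fls_subdegree (A $ 2 $ 2) = 0"
proof -
  obtain B where B: "A = to_F B" "invertible B" "residue_mat B \<in> borel2"
    using assms by (auto simp: iwahori_def)
  have c: "fps_nth (B $ 2 $ 1) 0 = 0"
    using B(3) by (simp add: borel2_def residue_mat_def)
  have "fps_nth (det B) 0 \<noteq> 0"
    using B(2) by (simp add: invertible_mat2_iff)
  \<comment> \<open>Modulo \<epsilon> the determinant is the product of the diagonal entries, so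
    neither of them vanishes there.\<close>
  then have u: "(B $ 1 $ 1) dvd 1" "(B $ 2 $ 2) dvd 1"
    using c by (auto simp: det_2)
  show "A \<in> K_O"
    using B by (simp add: K_O_def)
  show "val_ge 1 (A $ 2 $ 1)"
    using c by (auto simp: B(1) to_F_def val_ge_iff_nth)
  show "A $ 1 $ 1 \<noteq> 0" "fls_subdegree (A $ 1 $ 1) = 0" "A $ 2 $ 2 \<noteq> 0" "fls_subdegree (A $ 2 $ 2) = 0"
    using u unfolding fps_to_fls_unit_iff by (simp_all add: B(1) to_F_def)
qed


section \<open>The affine Springer fiber and the Iwahori orbits\<close>

text \<open>The preimage of the affine Springer fiber in the group, on which the centralizer acts
  from the left and \<open>K_O\<close> from the right.\<close>

definition integral_conjugators :: "'a::finite_field fls^2^2 \<Rightarrow> ('a fls^2^2) set" where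
  "integral_conjugators \<gamma> = {g \<in> carrier GL2. Ad (matrix_inv g) \<gamma> \<in> g_O}"

text \<open>A conjugate can then be found by guessing \<open>Y\<close> and checking an identity free
  of inverses. The proof has to remove the double inverse that \<open>Ad\<close> produces.\<close>

lemma Ad_matrix_inv_eqI:
  assumes "invertible g" "\<gamma> ** g = g ** Y"
  shows "Ad (matrix_inv g) \<gamma> = Y"
proof -
  have "invertible (matrix_inv g)"
    using assms(1) unfolding invertible_def[of "matrix_inv g"] by (blast intro: matrix_inv_inverse)
  then have "matrix_inv (matrix_inv g) = (g ** matrix_inv g) ** matrix_inv (matrix_inv g)"
    using assms(1) by (simp add: matrix_inv_inverse)
  also have "\<dots> = g"
    using \<open>invertible (matrix_inv g)\<close> by (simp add: matrix_inv_inverse flip: matrix_mul_assoc)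
  finally have "matrix_inv (matrix_inv g) = g" .
  then have "Ad (matrix_inv g) \<gamma> = matrix_inv g ** (\<gamma> ** g)"
    by (simp add: Ad_def matrix_mul_assoc)
  also have "\<dots> = Y"
    using assms by (simp add: matrix_inv_inverse matrix_mul_assoc)
  finally show ?thesis .
qed

lemma integral_conjugators_iff:
  "g \<in> integral_conjugators \<gamma> \<longleftrightarrow> invertible g \<and> (\<exists>Y\<in>g_O. \<gamma> ** g = g ** Y)"
proof (cases "invertible g")
  case True
  then have "\<gamma> ** g = g ** (matrix_inv g ** \<gamma> ** g)"
    by (simp add: matrix_inv_inverse matrix_mul_assoc)
  then have "\<gamma> ** g = g ** Ad (matrix_inv g) \<gamma>"
    using Ad_matrix_inv_eqI[OF True] by metis
  then have "Ad (matrix_inv g) \<gamma> \<in> g_O \<longleftrightarrow> (\<exists>Y\<in>g_O. \<gamma> ** g = g ** Y)"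
    using Ad_matrix_inv_eqI[OF True] by blast
  then show ?thesis
    using True by (simp add: integral_conjugators_def)
qed (simp add: integral_conjugators_def)

text \<open>Right translation by \<open>k\<close> replaces the conjugate \<open>Y\<close> by
  \<open>matrix_inv k ** Y ** k\<close>, which is again integral.\<close>

lemma integral_conjugators_mult_K_O:
  assumes "g \<in> integral_conjugators \<gamma>" "k \<in> K_O"
  shows "g ** k \<in> integral_conjugators \<gamma>"
proof -
  obtain Y where Y: "invertible g" "Y \<in> g_O" "\<gamma> ** g = g ** Y"
    using assms(1) by (auto simp: integral_conjugators_iff)
  have "g ** k ** (matrix_inv k ** Y ** k) = g ** (k ** matrix_inv k) ** Y ** k"
    by (simp only: matrix_mul_assoc)
  also have "\<dots> = \<gamma> ** (g ** k)"
    using assms(2) Y(3) by (simp add: K_O_invertible matrix_inv_inverse matrix_mul_assoc)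
  finally have "\<gamma> ** (g ** k) = g ** k ** (matrix_inv k ** Y ** k)" ..
  moreover have "matrix_inv k ** Y ** k \<in> g_O"
    using Y(2) assms(2) K_O_matrix_inv[OF assms(2)] by (simp add: g_O_mult K_O_iff)
  ultimately show ?thesis
    using Y(1) assms(2) by (auto simp: integral_conjugators_iff invertible_mult K_O_invertible)
qed

text \<open>Left translation by an element commuting with \<gamma> leaves the conjugate
  \<open>Y\<close> unchanged.\<close>

lemma centralizer_mult_integral_conjugators:
  assumes "t \<in> centralizer \<gamma>" "g \<in> integral_conjugators \<gamma>"
  shows "t ** g \<in> integral_conjugators \<gamma>"
proof -
  obtain Y where Y: "invertible g" "Y \<in> g_O" "\<gamma> ** g = g ** Y"
    using assms(2) by (auto simp: integral_conjugators_iff)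
  have t: "invertible t" "t ** \<gamma> = \<gamma> ** t"
    using assms(1) by (auto simp: centralizer_def)
  have "\<gamma> ** (t ** g) = t ** (\<gamma> ** g)"
    by (simp add: matrix_mul_assoc t(2))
  then have "\<gamma> ** (t ** g) = t ** g ** Y"
    by (simp add: matrix_mul_assoc Y(3))
  then show ?thesis
    using t(1) Y(1,2) by (auto simp: integral_conjugators_iff invertible_mult)
qed

lemma lcos_K_O_eq_iff:
  assumes "invertible g" "invertible h"
  shows "g <#\<^bsub>GL2\<^esub> K_O = h <#\<^bsub>GL2\<^esub> K_O \<longleftrightarrow> (\<exists>k\<in>K_O. h = g ** k)"
proof
  assume "g <#\<^bsub>GL2\<^esub> K_O = h <#\<^bsub>GL2\<^esub> K_O"
  then have "h \<in> g <#\<^bsub>GL2\<^esub> K_O"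
    using GL2.lcos_self[of h K_O] assms(2) subgroup_K_O by simp
  then show "\<exists>k\<in>K_O. h = g ** k"
    by (auto simp: l_coset_def)
next
  assume "\<exists>k\<in>K_O. h = g ** k"
  then show "g <#\<^bsub>GL2\<^esub> K_O = h <#\<^bsub>GL2\<^esub> K_O"
    using assms(1) by (intro GL2.l_repr_independence subgroup_K_O) (auto simp: l_coset_def)
qed

lemma affine_springer_fiber_eq:
  "affine_springer_fiber \<gamma> = (\<lambda>g. g <#\<^bsub>GL2\<^esub> K_O) ` integral_conjugators \<gamma>"
  unfolding affine_springer_fiber_def integral_conjugators_def by blast

text \<open>The fiber is defined by the existence of a good representative; right invariance under
  \<open>K_O\<close> makes every representative good.\<close>

lemma lcos_in_affine_springer_fiber_iff:
  assumes "invertible g"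
  shows "g <#\<^bsub>GL2\<^esub> K_O \<in> affine_springer_fiber \<gamma> \<longleftrightarrow> g \<in> integral_conjugators \<gamma>"
proof
  assume "g <#\<^bsub>GL2\<^esub> K_O \<in> affine_springer_fiber \<gamma>"
  then obtain h where h: "h \<in> integral_conjugators \<gamma>" "h <#\<^bsub>GL2\<^esub> K_O = g <#\<^bsub>GL2\<^esub> K_O"
    by (auto simp: affine_springer_fiber_eq)
  then have "invertible h" by (simp add: integral_conjugators_iff)
  then show "g \<in> integral_conjugators \<gamma>"
    using h assms by (auto simp: lcos_K_O_eq_iff integral_conjugators_mult_K_O)
qed (simp add: affine_springer_fiber_eq)

lemma integral_conjugators_iff_val:
  fixes u :: "'a::finite_field fls"
  assumes "u \<noteq> 0" and m: "m = fls_subdegree (det g) - fls_subdegree u"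
  shows "g \<in> integral_conjugators (mat2 0 u (fls_X * u) 0) \<longleftrightarrow> invertible g \<and>
    (g $ 1 $ 1 = 0 \<or> m \<le> 2 * fls_subdegree (g $ 1 $ 1) + 1) \<and>
    (g $ 1 $ 2 = 0 \<or> m \<le> 2 * fls_subdegree (g $ 1 $ 2) + 1) \<and>
    (g $ 2 $ 1 = 0 \<or> m \<le> 2 * fls_subdegree (g $ 2 $ 1)) \<and>
    (g $ 2 $ 2 = 0 \<or> m \<le> 2 * fls_subdegree (g $ 2 $ 2))"
proof (cases "invertible g")
  case True
  define a b c d where abcd: "a = g $ 1 $ 1" "b = g $ 1 $ 2" "c = g $ 2 $ 1" "d = g $ 2 $ 2"
  have g: "g = mat2 a b c d"
    by (simp add: abcd flip: mat2_eq)
  define D where "D = a * d - b * c"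
  have D: "det g = D"
    by (simp add: D_def abcd det_2)
  with True have D0: "D \<noteq> 0"
    by (simp add: invertible_det_nz)
  define r where "r = u / D"
  have r: "u = r * D" "r \<noteq> 0" "fls_subdegree r = - m"
    using D0 \<open>u \<noteq> 0\<close> by (simp_all add: r_def m D fls_divide_subdegree)
  \<comment> \<open>The product \<open>matrix_inv g ** \<gamma> ** g\<close> written out with the
    adjugate of \<open>g\<close>; the factor \<open>r\<close> has valuation
    \<open>- m\<close>.\<close>
  define Y where "Y = mat2 (r * (c * d - fls_X * a * b)) (r * (d * d - fls_X * b * b))
    (- (r * (c * c - fls_X * a * a))) (- (r * (c * d - fls_X * a * b)))"
  have "mat2 0 u (fls_X * u) 0 ** g = g ** Y"
    unfolding g Y_def mat2_mult r(1) D_def by (simp add: vec_eq_iff forall_2 algebra_simps)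
  then have "g \<in> integral_conjugators (mat2 0 u (fls_X * u) 0) \<longleftrightarrow> Y \<in> g_O"
    using Ad_matrix_inv_eqI[OF True] True by (simp add: integral_conjugators_def)
  also have "\<dots> \<longleftrightarrow> val_ge m (c * d - fls_X * a * b) \<and> val_ge m (d * d - fls_X * b * b) \<and>
      val_ge m (c * c - fls_X * a * a)"
    using r by (auto simp: g_O_iff Y_def forall_2 val_ge_mult_cancel)
  also have "\<dots> \<longleftrightarrow> val_ge m (d * d - fls_X * b * b) \<and> val_ge m (c * c - fls_X * a * a)"
  proof -
    \<comment> \<open>The bounds for \<open>c\<close> and \<open>d\<close> add up to twice the one
      for \<open>c * d\<close>, and those for \<open>a\<close> and \<open>b\<close> to twice the one
      for \<open>fls_X * a * b\<close>.\<close>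
    have "val_ge m (c * d - fls_X * a * b)"
      if "val_ge m (d * d - fls_X * b * b)" "val_ge m (c * c - fls_X * a * a)"
    proof (rule val_ge_diff)
      show "val_ge m (c * d)" "val_ge m (fls_X * a * b)"
        using that unfolding val_ge_norm_form
        by (cases "a = 0"; cases "b = 0"; cases "c = 0"; cases "d = 0"; simp add: val_ge_def; linarith)+
    qed
    then show ?thesis by blast
  qed
  finally show ?thesis
    using True unfolding val_ge_norm_form abcd by blast
qed (simp add: integral_conjugators_iff)

text \<open>The diagonal entries of \<open>k\<close> are units, so entry (1,1) yields the lower
  bound and entry (2,2) the upper one. They imply the conditions off the diagonal:
  \<open>k $ 1 $ 2\<close> is integral, and \<open>k $ 2 $ 1\<close> is even divisible by
  \<epsilon>.\<close>

lemma iwahori_diag_integral_iff: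
  fixes u :: "'a::finite_field fls"
  assumes k: "k \<in> iwahori" and "p \<noteq> 0" "q \<noteq> 0" "u \<noteq> 0"
  shows "k ** mat2 p 0 0 q \<in> integral_conjugators (mat2 0 u (fls_X * u) 0) \<longleftrightarrow>
    - (fls_subdegree u + 1) \<le> fls_subdegree p - fls_subdegree q \<and>
    fls_subdegree p - fls_subdegree q \<le> fls_subdegree u"
proof -
  note kD = iwahoriD[OF k]
  let ?g = "k ** mat2 p 0 0 q"
  have dk: "det k \<noteq> 0" "fls_subdegree (det k) = 0" and k12: "val_ge 0 (k $ 1 $ 2)"
    using kD(1) by (simp_all add: K_O_iff g_O_iff)
  have det: "det ?g = det k * (p * q)"
    using det_2[of "mat2 p 0 0 q"] by (simp add: det_mul)
  then have inv: "invertible ?g"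
    using dk assms by (simp add: invertible_det_nz)
  have sub: "fls_subdegree (det ?g) = fls_subdegree p + fls_subdegree q"
    using dk assms by (simp add: det)
  have nth: "?g $ 1 $ 1 = k $ 1 $ 1 * p" "?g $ 1 $ 2 = k $ 1 $ 2 * q"
    "?g $ 2 $ 1 = k $ 2 $ 1 * p" "?g $ 2 $ 2 = k $ 2 $ 2 * q"
    by (simp_all add: matrix_matrix_mult_def sum_2)
  show ?thesis
    unfolding integral_conjugators_iff_val[OF \<open>u \<noteq> 0\<close> refl] sub nth
    using inv kD(2-) k12 assms(2,3)
    by (cases "k $ 1 $ 2 = 0"; cases "k $ 2 $ 1 = 0"; simp add: val_ge_def; linarith)
qed

lemma affine_springer_fiber_Int_iwahori_orbit:
  fixes u :: "'a::finite_field fls"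
  assumes "u \<noteq> 0"
  shows "affine_springer_fiber (mat2 0 u (fls_X * u) 0) \<inter> iwahori_orbit a b =
    (if - (fls_subdegree u + 1) \<le> a - b \<and> a - b \<le> fls_subdegree u then iwahori_orbit a b else {})"
proof -
  \<comment> \<open>The criterion does not involve \<open>k\<close>, so an orbit lies entirely
    inside or entirely outside the fiber.\<close>
  have "(k ** mat2 (fls_X powi a) 0 0 (fls_X powi b)) <#\<^bsub>GL2\<^esub> K_O
      \<in> affine_springer_fiber (mat2 0 u (fls_X * u) 0) \<longleftrightarrow>
    - (fls_subdegree u + 1) \<le> a - b \<and> a - b \<le> fls_subdegree u" if k: "k \<in> iwahori" for k :: "'a fls^2^2"
  proof -
    let ?t = "mat2 (fls_X powi a) 0 0 (fls_X powi b) :: 'a fls^2^2"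
    have "invertible ?t"
      by (simp add: invertible_det_nz det_2 del: fls_X_power_int)
    then have "invertible (k ** ?t)"
      using K_O_invertible[OF iwahoriD(1)[OF k]] by (simp add: invertible_mult)
    then show ?thesis
      using iwahori_diag_integral_iff[OF k _ _ assms, of "fls_X powi a" "fls_X powi b"]
      by (simp add: lcos_in_affine_springer_fiber_iff del: fls_X_power_int)
  qed
  then show ?thesis
    unfolding iwahori_orbit_def by auto
qed


section \<open>Counting the points of the fundamental domain\<close>

text \<open>For \<open>l \<le> r\<close> these are the truncated series representing \<epsilon>^l
  \<O> modulo \<epsilon>^r \<O>.\<close>

definition fls_window :: "int \<Rightarrow> int \<Rightarrow> 'a::zero fls set" where
  "fls_window l r = {x. \<forall>k. fls_nth x k \<noteq> 0 \<longrightarrow> k \<in> {l..<r}}"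

lemma card_fls_window: "card (fls_window l r :: 'a::{zero,finite} fls set) = CARD('a) ^ nat (r - l)"
proof -
  define F :: "(int \<Rightarrow> 'a) \<Rightarrow> 'a fls" where "F f = Abs_fls (\<lambda>k. if k \<in> {l..<r} then f k else 0)" for f
  have nth: "fls_nth (F f) = (\<lambda>k. if k \<in> {l..<r} then f k else 0)" for f
    unfolding F_def by (rule ext, rule nth_Abs_fls_ex_lower_bound, rule exI[of _ l]) simp
  have "bij_betw F (PiE {l..<r} (\<lambda>_. UNIV)) (fls_window l r)"
  proof (rule bij_betwI[where g = "\<lambda>x. restrict (fls_nth x) {l..<r}"])
    show "F \<in> (PiE {l..<r} (\<lambda>_. UNIV)) \<rightarrow> fls_window l r"
      by (auto simp: fls_window_def nth split: if_splits)
    show "restrict (fls_nth (F f)) {l..<r} = f" if "f \<in> PiE {l..<r} (\<lambda>_. UNIV)" for f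
      using that by (auto simp: nth fun_eq_iff PiE_def extensional_def)
    show "F (restrict (fls_nth x) {l..<r}) = x" if "x \<in> fls_window l r" for x
      using that by (intro fls_eqI) (auto simp: nth fls_window_def)
  qed auto
  then show ?thesis
    using bij_betw_same_card card_PiE[of "{l..<r}" "\<lambda>_. UNIV :: 'a set"] by fastforce
qed

text \<open>The opposite exponents give determinant 1, which suits the component where the
  determinant has valuation 0.\<close>

definition hermite_mat :: "int \<Rightarrow> 'a::finite_field fls \<Rightarrow> 'a fls^2^2" where
  "hermite_mat a x = mat2 (fls_X powi a) x 0 (fls_X powi (- a))"

lemma hermite_mat_nth [simp]:
  "hermite_mat a x $ 1 $ 1 = fls_X powi a" "hermite_mat a x $ 1 $ 2 = x"
  "hermite_mat a x $ 2 $ 1 = 0" "hermite_mat a x $ 2 $ 2 = fls_X powi (- a)"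
  by (simp_all add: hermite_mat_def)

lemma det_hermite_mat [simp]: "det (hermite_mat a x) = 1"
  by (simp add: det_2 power_int_minus del: fls_X_power_int)

lemma invertible_hermite_mat [simp]: "invertible (hermite_mat a x)"
  by (simp add: invertible_det_nz)

lemma mat2_eq_iff: "mat2 a b c d = mat2 a' b' c' d' \<longleftrightarrow> a = a' \<and> b = b' \<and> c = c' \<and> d = d'"
  by (auto simp: vec_eq_iff forall_2)

lemma mat2_in_K_O_iff:
  "mat2 a b c d \<in> K_O \<longleftrightarrow> val_ge 0 a \<and> val_ge 0 b \<and> val_ge 0 c \<and> val_ge 0 d \<and>
    a * d - b * c \<noteq> 0 \<and> fls_subdegree (a * d - b * c) = 0"
  by (auto simp: K_O_iff g_O_iff forall_2 det_2)

text \<open>A Euclidean step on the bottom row: the entry of least valuation clears the other one. A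
  pivot on the left also requires a swap of the columns.\<close>

lemma ex_K_O_upper_triangular:
  fixes g :: "'a::finite_field fls^2^2"
  assumes "invertible g"
  shows "\<exists>k\<in>K_O. (g ** k) $ 2 $ 1 = 0"
proof -
  define c d where cd: "c = g $ 2 $ 1" "d = g $ 2 $ 2"
  have "c \<noteq> 0 \<or> d \<noteq> 0"
    using assms by (auto simp: invertible_det_nz det_2 cd)
  then consider "d \<noteq> 0" "val_ge (fls_subdegree d) c" | "c \<noteq> 0" "val_ge (fls_subdegree c) d"
    unfolding val_ge_def by fastforce
  then show ?thesis
  proof cases
    case 1
    then have "mat2 1 0 (- (c / d)) 1 \<in> K_O"
      by (simp add: mat2_in_K_O_iff val_ge_divide) (simp add: val_ge_def)
    moreover have "(g ** mat2 1 0 (- (c / d)) 1) $ 2 $ 1 = 0"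
      using 1 by (simp add: matrix_matrix_mult_def sum_2 flip: cd)
    ultimately show ?thesis by blast
  next
    case 2
    then have "mat2 (- (d / c)) 1 1 0 \<in> K_O"
      by (simp add: mat2_in_K_O_iff val_ge_divide) (simp add: val_ge_def)
    moreover have "(g ** mat2 (- (d / c)) 1 1 0) $ 2 $ 1 = 0"
      using 2 by (simp add: matrix_matrix_mult_def sum_2 flip: cd)
    ultimately show ?thesis by blast
  qed
qed

lemma ex_K_O_hermite_mat:
  fixes g :: "'a::finite_field fls^2^2"
  assumes "invertible g" "fls_subdegree (det g) = 0"
  shows "\<exists>k\<in>K_O. \<exists>a x. g ** k = hermite_mat a x \<and> (\<forall>j\<ge>a. fls_nth x j = 0)"
proof -
  obtain k1 where k1: "k1 \<in> K_O" "(g ** k1) $ 2 $ 1 = 0"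
    using ex_K_O_upper_triangular[OF assms(1)] by blast
  define p y q where pyq: "p = (g ** k1) $ 1 $ 1" "y = (g ** k1) $ 1 $ 2" "q = (g ** k1) $ 2 $ 2"
  have gk1: "g ** k1 = mat2 p y 0 q"
    using mat2_eq[of "g ** k1"] k1(2) by (simp add: pyq)
  have "det (g ** k1) \<noteq> 0" "fls_subdegree (det (g ** k1)) = 0"
    using assms k1(1) by (simp_all add: det_mul K_O_iff invertible_det_nz)
  then have pq: "p \<noteq> 0" "q \<noteq> 0" "fls_subdegree q = - fls_subdegree p"
    by (auto simp: gk1 det_2)
  define a where "a = fls_subdegree p"
  define P :: "'a fls" where "P = fls_X powi a"
  have P: "P \<noteq> 0" "fls_subdegree P = a" "fls_X powi (- a) = inverse P"
    by (simp_all add: P_def power_int_minus del: fls_X_power_int)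
  \<comment> \<open>The units \<open>r\<close> and \<open>s\<close> turn the diagonal into powers of
    \<epsilon>, which changes \<open>y\<close> to \<open>z\<close>. The integral \<open>w\<close> is
    chosen so that \<open>P * w\<close> cancels all terms of \<open>z\<close> of degree at least
    \<open>a\<close>.\<close>
  define z where "z = y * inverse P / q"
  define w where "w = - fps_to_fls (fls_regpart (z / P))"
  define r s where rs: "r = P / p" "s = inverse P / q"
  define k2 where "k2 = mat2 r (r * w) 0 s"
  have u: "r \<noteq> 0" "s \<noteq> 0" "fls_subdegree r = 0" "fls_subdegree s = 0"
    using pq P by (simp_all add: rs fls_divide_subdegree a_def)
  have "val_ge 0 w"
    by (simp add: w_def del: fps_to_fls_regpart)
  moreover have "val_ge 0 r" "val_ge 0 s"
    using u by (simp_all add: val_ge_def)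
  ultimately have "k2 \<in> K_O"
    using u val_ge_0_mult[of r w] by (simp add: k2_def mat2_in_K_O_iff)
  moreover have "g ** k1 ** k2 = hermite_mat a (P * w + z)"
    using pq(1,2) P(1,3) by (simp add: gk1 k2_def rs mat2_mult hermite_mat_def z_def del: fls_X_power_int flip: P_def)
  moreover have "fls_nth (P * w + z) j = 0" if "j \<ge> a" for j
  proof -
    have "fls_nth (P * (w + z / P)) j = fls_nth (w + z / P) (j - a)"
      by (simp add: P_def fls_X_intpow_times_conv_shift)
    also have "\<dots> = 0"
      using that by (simp add: w_def)
    finally show ?thesis
      using P(1) by (simp add: distrib_left)
  qed
  ultimately show ?thesis
    using k1(1) by (metis K_O_mult matrix_mul_assoc)
qed

lemma hermite_mat_lcos_inject:
  fixes x y :: "'a::finite_field fls"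
  assumes eq: "hermite_mat a x <#\<^bsub>GL2\<^esub> K_O = hermite_mat b y <#\<^bsub>GL2\<^esub> K_O"
    and x: "\<forall>j\<ge>a. fls_nth x j = 0" and y: "\<forall>j\<ge>b. fls_nth y j = 0"
  shows "a = b \<and> x = y"
proof -
  obtain k where k: "k \<in> K_O" "hermite_mat b y = hermite_mat a x ** k"
    using eq lcos_K_O_eq_iff[of "hermite_mat a x" "hermite_mat b y"] by auto
  define P Q :: "'a fls" where PQ: "P = fls_X powi a" "Q = fls_X powi b"
  have P: "P \<noteq> 0" "fls_subdegree P = a" "fls_X powi (- a) = inverse P"
    and Q: "Q \<noteq> 0" "fls_subdegree Q = b" "fls_X powi (- b) = inverse Q"
    by (simp_all add: PQ power_int_minus del: fls_X_power_int)
  have v: "val_ge 0 (k $ i $ j)" for i j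
    using k(1) by (simp add: K_O_iff g_O_iff)
  have "mat2 Q y 0 (inverse Q) = mat2 P x 0 (inverse P) ** mat2 (k $ 1 $ 1) (k $ 1 $ 2) (k $ 2 $ 1) (k $ 2 $ 2)"
    using k(2) unfolding hermite_mat_def P(3) Q(3) PQ[symmetric] mat2_eq[symmetric] .
  then have e: "Q = P * k $ 1 $ 1 + x * k $ 2 $ 1" "y = P * k $ 1 $ 2 + x * k $ 2 $ 2"
    "0 = inverse P * k $ 2 $ 1" "inverse Q = inverse P * k $ 2 $ 2"
    unfolding mat2_mult mat2_eq_iff mult_zero_left add_0_left by blast+
  then have Q': "Q = P * k $ 1 $ 1" and P': "P = Q * k $ 2 $ 2"
    using P(1) Q(1) by (simp_all add: field_simps)
  have nz: "k $ 1 $ 1 \<noteq> 0" "k $ 2 $ 2 \<noteq> 0"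
    using Q' P' P(1) Q(1) by auto
  \<comment> \<open>The diagonal entries of the transition matrix \<open>k\<close> are integral,
    which gives both \<open>a \<le> b\<close> and \<open>b \<le> a\<close>.\<close>
  have "b = a + fls_subdegree (k $ 1 $ 1)" "a = b + fls_subdegree (k $ 2 $ 2)"
    using Q' P' P(1,2) Q(1,2) nz by (metis fls_subdegree_mult)+
  moreover have "fls_subdegree (k $ 1 $ 1) \<ge> 0" "fls_subdegree (k $ 2 $ 2) \<ge> 0"
    using v nz by (auto simp: val_ge_def)
  ultimately have ab: "a = b"
    by simp
  then have "k $ 2 $ 2 = 1"
    using P' P(1) PQ by simp
  then have "y - x = P * k $ 1 $ 2"
    using e(2) by simp
  then have "val_ge a (y - x)"
    using v[of 1 2] P by (simp add: val_ge_mult_cancel)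
  \<comment> \<open>Coefficients below \<open>a\<close> vanish because \<open>y - x\<close> lies in
    \<epsilon>^a \<O>, the others because \<open>x\<close> and \<open>y\<close> are
    truncated.\<close>
  then have "fls_nth (y - x) j = 0" for j
    using x y ab by (cases "j < a") (auto simp: val_ge_iff_nth)
  then have "y - x = 0"
    by (intro fls_eqI) simp
  then show ?thesis
    using ab by simp
qed

lemma fundamental_domain_eq:
  "fundamental_domain \<gamma> = (\<lambda>g. g <#\<^bsub>GL2\<^esub> K_O) ` {g \<in> integral_conjugators \<gamma>. fls_subdegree (det g) = 0}"
  unfolding fundamental_domain_def integral_conjugators_def by auto

text \<open>The determinant is 1, so the entry criterion applies with \<open>m = - int n\<close>.
  Both entries of the top row get the bound \<open>- (n + 1) / 2\<close>, rounded up to an integer;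
  entry (2,2) bounds \<open>a\<close> from above.\<close>

lemma hermite_mat_integral_iff:
  fixes u :: "'a::finite_field fls"
  assumes "u \<noteq> 0" "fls_subdegree u = int n"
  shows "hermite_mat a x \<in> integral_conjugators (mat2 0 u (fls_X * u) 0) \<longleftrightarrow>
    a \<in> {- int ((n + 1) div 2)..int (n div 2)} \<and> val_ge (- int ((n + 1) div 2)) x"
  unfolding integral_conjugators_iff_val[OF assms(1) refl] assms(2)
  by (simp add: val_ge_def del: fls_X_power_int) (simp add: zdiv_int; linarith)

lemma bij_betw_fundamental_domain:
  fixes u :: "'a::finite_field fls"
  assumes "u \<noteq> 0" "fls_subdegree u = int n"
  defines "N \<equiv> int ((n + 1) div 2)"
  shows "bij_betw (\<lambda>(a, x). hermite_mat a x <#\<^bsub>GL2\<^esub> K_O)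
    (SIGMA a:{- N..int (n div 2)}. fls_window (- N) a)
    (fundamental_domain (mat2 0 u (fls_X * u) 0))"
proof (rule bij_betw_imageI)
  show "inj_on (\<lambda>(a, x). hermite_mat a x <#\<^bsub>GL2\<^esub> K_O)
    (SIGMA a:{- N..int (n div 2)}. (fls_window (- N) a :: 'a fls set))"
    by (rule inj_onI) (auto simp: fls_window_def dest!: hermite_mat_lcos_inject)
next
  let ?S = "integral_conjugators (mat2 0 u (fls_X * u) 0)"
  show "(\<lambda>(a, x). hermite_mat a x <#\<^bsub>GL2\<^esub> K_O) ` (SIGMA a:{- N..int (n div 2)}. fls_window (- N) a)
    = fundamental_domain (mat2 0 u (fls_X * u) 0)"
  proof (intro equalityI subsetI)
    fix c assume "c \<in> (\<lambda>(a, x). hermite_mat a x <#\<^bsub>GL2\<^esub> K_O) `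
      (SIGMA a:{- N..int (n div 2)}. (fls_window (- N) a :: 'a fls set))"
    then obtain a and x :: "'a fls" where ax: "a \<in> {- N..int (n div 2)}" "x \<in> fls_window (- N) a"
      and c: "c = hermite_mat a x <#\<^bsub>GL2\<^esub> K_O"
      by auto
    have "val_ge (- N) x"
      using ax(2) by (fastforce simp: fls_window_def val_ge_iff_nth)
    then have "hermite_mat a x \<in> ?S"
      using ax(1) hermite_mat_integral_iff[OF assms(1,2)] by (simp add: N_def)
    then show "c \<in> fundamental_domain (mat2 0 u (fls_X * u) 0)"
      by (auto simp: c fundamental_domain_eq)
  next
    fix c assume "c \<in> fundamental_domain (mat2 0 u (fls_X * u) 0)"
    then obtain g where g: "g \<in> ?S" "fls_subdegree (det g) = 0" "c = g <#\<^bsub>GL2\<^esub> K_O"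
      by (auto simp: fundamental_domain_eq)
    then have inv: "invertible g"
      by (simp add: integral_conjugators_iff)
    obtain k a x where kax: "k \<in> K_O" "g ** k = hermite_mat a x" "\<forall>j\<ge>a. fls_nth x j = 0"
      using ex_K_O_hermite_mat[OF inv g(2)] by blast
    have c: "c = hermite_mat a x <#\<^bsub>GL2\<^esub> K_O"
        unfolding g(3) lcos_K_O_eq_iff[OF inv invertible_hermite_mat] using kax(1) kax(2)[symmetric] by blast
    have "hermite_mat a x \<in> ?S"
      using integral_conjugators_mult_K_O[OF g(1) kax(1)] kax(2) by simp
    then have "a \<in> {- N..int (n div 2)}" "val_ge (- N) x"
      using hermite_mat_integral_iff[OF assms(1,2)] by (simp_all add: N_def)
    moreover from this(2) kax(3) have "x \<in> fls_window (- N) a"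
      by (auto simp: fls_window_def val_ge_iff_nth not_less[symmetric])
    ultimately show "c \<in> (\<lambda>(a, x). hermite_mat a x <#\<^bsub>GL2\<^esub> K_O) `
      (SIGMA a:{- N..int (n div 2)}. fls_window (- N) a)"
      unfolding c by force
  qed
qed

lemma finite_fls_window: "finite (fls_window l r :: 'a::{zero,finite} fls set)"
  by (rule card_ge_0_finite) (simp add: card_fls_window)

lemma finite_fundamental_domain:
  fixes u :: "'a::finite_field fls"
  assumes "u \<noteq> 0" "fls_subdegree u = int n"
  shows "finite (fundamental_domain (mat2 0 u (fls_X * u) 0))"
  using bij_betw_finite[OF bij_betw_fundamental_domain[OF assms]] by (simp add: finite_fls_window)

lemma card_fundamental_domain:
  fixes u :: "'a::finite_field fls"
  assumes "u \<noteq> 0" "fls_subdegree u = int n"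
  shows "card (fundamental_domain (mat2 0 u (fls_X * u) 0)) = (\<Sum>i=0..n. CARD('a) ^ i)"
proof -
  define N where "N = int ((n + 1) div 2)"
  have "card (fundamental_domain (mat2 0 u (fls_X * u) 0))
    = card (SIGMA a:{- N..int (n div 2)}. (fls_window (- N) a :: 'a fls set))"
    using bij_betw_same_card[OF bij_betw_fundamental_domain[OF assms]] by (simp add: N_def)
  also have "\<dots> = (\<Sum>a\<in>{- N..int (n div 2)}. CARD('a) ^ nat (a + N))"
    by (simp add: card_SigmaI finite_fls_window card_fls_window)
  also have "\<dots> = (\<Sum>i=0..n. CARD('a) ^ i)"
  proof (rule sum.reindex_bij_witness[where i = "\<lambda>i. int i - N" and j = "\<lambda>a. nat (a + N)"])
    \<comment> \<open>The halves of \<open>n\<close>, rounded up and down, add up to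
      \<open>n\<close>, so the exponent \<open>a + N\<close> takes each value from 0 to
      \<open>n\<close> once.\<close>
    have n: "int n = N + int (n div 2)"
      unfolding N_def by presburger
    show "nat (a + N) \<in> {0..n}" if "a \<in> {- N..int (n div 2)}" for a
      using that n by auto
    show "int i - N \<in> {- N..int (n div 2)}" if "i \<in> {0..n}" for i
      using that n by auto
  qed auto
  finally show ?thesis .
qed


section \<open>The orbital integral\<close>

lemma open_val_ge: "open {z. val_ge m (z - a)}"
  for a :: "'a::ring fls"
  unfolding open_fls_def
proof
  fix b assume "b \<in> {z. val_ge m (z - a)}"
  then have b: "val_ge m (b - a)" by simp
  have "val_ge m (y - a)" if d: "dist y b < inverse (2 ^ nat m)" for y
  proof -
    have "val_ge m (y - b)"
    proof (rule ccontr)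
      assume "\<not> val_ge m (y - b)"
      then have yb: "y \<noteq> b" "fls_subdegree (y - b) < m"
        by (auto simp: val_ge_def)
      \<comment> \<open>For negative \<open>m\<close> the radius is 1, since \<open>nat\<close>
        truncates; this suffices because a negative valuation means distance at least 1.\<close>
      have "inverse (2 ^ nat m) \<le> dist y b"
      proof (cases "fls_subdegree (y - b) \<ge> 0")
        case True
        then show ?thesis
          using yb by (simp add: dist_fls_def)
      next
        case False
        have "inverse (2 ^ nat m) \<le> (1 :: real)"
          by (simp add: inverse_le_1_iff)
        also have "1 \<le> dist y b"
          using False yb by (simp add: dist_fls_def)
        finally show ?thesis .
      qed
      then show False
        using d by simp
    qed
    from val_ge_add[OF this b] show ?thesis by simp
  qed
  then show "\<exists>r>0. {y. dist y b < r} \<subseteq> {z. val_ge m (z - a)}"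
    by (intro exI[of _ "inverse (2 ^ nat m)"]) auto
qed

lemma open_entries_val_ge: "open {h :: 'a::ring fls^'m^'n. \<forall>i j. val_ge m (h $ i $ j - g $ i $ j)}"
proof -
  have "open ((\<lambda>h :: 'a fls^'m^'n. h $ i $ j) -` {z. val_ge m (z - g $ i $ j)})" for i j
    by (intro open_vimage open_val_ge continuous_intros)
  then have "open (\<Inter>i. \<Inter>j. (\<lambda>h :: 'a fls^'m^'n. h $ i $ j) -` {z. val_ge m (z - g $ i $ j)})"
    by (intro open_INT) auto
  also have "(\<Inter>i. \<Inter>j. (\<lambda>h :: 'a fls^'m^'n. h $ i $ j) -` {z. val_ge m (z - g $ i $ j)})
    = {h. \<forall>i j. val_ge m (h $ i $ j - g $ i $ j)}"
    by auto
  finally show ?thesis .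
qed

text \<open>The determinant is 1 modulo \<epsilon>, hence a unit. This puts a neighbourhood of the
  identity inside \<open>K_O\<close>.\<close>

lemma K_O_near_1:
  assumes "\<And>i j. val_ge 1 ((k - mat 1) $ i $ j)"
  shows "k \<in> K_O"
proof -
  define a b c d where abcd: "a = k $ 1 $ 1 - 1" "b = k $ 1 $ 2" "c = k $ 2 $ 1" "d = k $ 2 $ 2 - 1"
  have v: "val_ge 1 a" "val_ge 1 b" "val_ge 1 c" "val_ge 1 d"
    using assms[of 1 1] assms[of 1 2] assms[of 2 1] assms[of 2 2] by (simp_all add: abcd mat_def)
  then have v0: "val_ge 0 a" "val_ge 0 b" "val_ge 0 c" "val_ge 0 d"
    by (auto intro: val_ge_mono)
  have one: "val_ge 0 (1 :: 'a fls)"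
    by (simp add: val_ge_def)
  define e where "e = a + d + a * d - b * c"
  have e: "val_ge 1 e"
    unfolding e_def using v v0 val_ge_mult[of 1 a 0 d] val_ge_mult[of 1 b 0 c]
    by (intro val_ge_add val_ge_diff) simp_all
  then have "fls_nth (1 + e) 0 = 1" "\<forall>j<0. fls_nth (1 + e) j = 0"
    by (auto simp: val_ge_iff_nth)
  then have "1 + e \<noteq> 0" "fls_subdegree (1 + e) = 0"
    by (metis fls_zero_nth zero_neq_one) (metis \<open>fls_nth (1 + e) 0 = 1\<close> \<open>\<forall>j<0. fls_nth (1 + e) j = 0\<close> fls_subdegree_eqI zero_neq_one)
  moreover have "k = mat2 (1 + a) b c (1 + d)"
    using mat2_eq[of k] by (simp add: abcd)
  moreover have "(1 + a) * (1 + d) - b * c = 1 + e"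
    by (simp add: e_def algebra_simps)
  ultimately show ?thesis
    using v0 one by (simp add: mat2_in_K_O_iff val_ge_add)
qed

text \<open>A matrix close to \<open>g\<close> is \<open>g\<close> times an element of
  \<open>K_O\<close>. Openness is what makes the fiber measurable in the quotient.\<close>

lemma openin_integral_conjugators:
  "openin (top_of_set (carrier GL2)) (integral_conjugators \<gamma>)"
proof (subst openin_subopen, intro ballI)
  fix g assume g: "g \<in> integral_conjugators \<gamma>"
  then have inv: "invertible g"
    by (simp add: integral_conjugators_iff)
  \<comment> \<open>\<open>N\<close> bounds the pole orders in \<open>matrix_inv g\<close>, so
    changing \<open>g\<close> by a multiple of \<epsilon>^(N+1) changes
    \<open>matrix_inv g ** g\<close> by a multiple of \<epsilon>.\<close>
  define N where "N = (\<Sum>i\<in>UNIV. \<Sum>j\<in>UNIV. \<bar>fls_subdegree (matrix_inv g $ i $ j)\<bar>)"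
  have N: "val_ge (- N) (matrix_inv g $ i $ j)" for i j
  proof -
    have "\<bar>fls_subdegree (matrix_inv g $ i $ j)\<bar> \<le> N"
      using exhaust_2[of i] exhaust_2[of j] by (auto simp: N_def sum_2)
    then show ?thesis
      by (auto simp: val_ge_def)
  qed
  define W where "W = {h. \<forall>i j. val_ge (N + 1) (h $ i $ j - g $ i $ j)}"
  have "h \<in> integral_conjugators \<gamma>" if "h \<in> W" for h
  proof -
    define k where "k = matrix_inv g ** h"
    have "k - mat 1 = matrix_inv g ** (h - g)"
      using inv by (simp add: k_def matrix_inv_inverse vec_eq_iff matrix_matrix_mult_def sum_2 algebra_simps)
        (simp add: matrix_matrix_mult_def sum_2 vec_eq_iff flip: matrix_inv_inverse(2)[OF inv])
    then have "val_ge 1 ((k - mat 1) $ i $ j)" for i j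
      using that val_ge_mult[OF N, of "N + 1" "h $ _ $ j - g $ _ $ j"]
      by (simp add: W_def matrix_matrix_mult_def sum_2 val_ge_add)
    then have "g ** k \<in> integral_conjugators \<gamma>"
      by (intro integral_conjugators_mult_K_O g K_O_near_1)
    then show ?thesis
      using inv by (simp add: k_def matrix_inv_inverse matrix_mul_assoc)
  qed
  then show "\<exists>V. openin (top_of_set (carrier GL2)) V \<and> g \<in> V \<and> V \<subseteq> integral_conjugators \<gamma>"
    using inv open_entries_val_ge[of "N + 1" g]
    by (intro exI[of _ "carrier GL2 \<inter> W"]) (auto simp: W_def intro: openin_open_Int)
qed

section \<open>The torus and its cosets\<close>

lemma det_E_mat: "det (E_mat x y) = x * x - fls_X * y * y"
  by (simp add: E_mat_def det_2 algebra_simps)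

lemma fls_subdegree_det_E_mat: "fls_subdegree (det (E_mat x y)) = fls_subdegree (E_elt x y)"
  by (simp only: det_E_mat fls_subdegree_norm_form)

lemma O_E_units_eq: "O_E_units = {E_mat x y | x y. E_elt x y \<noteq> 0 \<and> fls_subdegree (E_elt x y) = 0}"
proof -
  have "e \<in> fps_to_fls ` {v. v dvd 1} \<longleftrightarrow> e \<noteq> 0 \<and> fls_subdegree e = 0" for e :: "'a fls"
  proof
    assume "e \<noteq> 0 \<and> fls_subdegree e = 0"
    moreover from this obtain f where "e = fps_to_fls f"
      using fps_to_fls_regpart[of e] by (metis order_refl val_ge_def)
    ultimately show "e \<in> fps_to_fls ` {v. v dvd 1}"
      unfolding fps_to_fls_unit_iff by blast
  qed (auto simp: fps_to_fls_unit_iff simp del: fps_is_unit_iff fps_to_fls_eq_0_iff)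
  then show ?thesis
    by (auto simp: O_E_units_def)
qed

text \<open>The determinant on the torus is the norm from \<open>E\<close>, so its valuation is the
  one of \<open>E\<close>; the elements of valuation \<open>j\<close> are the units times the
  \<open>j\<close>-th power of a uniformizer.\<close>

lemma centralizer_val_det_eq_coset:
  fixes u :: "'a::finite_field fls"
  assumes "u \<noteq> 0"
  defines "T \<equiv> centralizer (mat2 0 u (fls_X * u) 0)"
  shows "\<exists>t\<in>T. {s \<in> T. fls_subdegree (det s) = j} = t <#\<^bsub>GL2\<^esub> O_E_units"
proof -
  have T: "T = {E_mat x y | x y. E_elt x y \<noteq> 0}"
    unfolding T_def by (rule centralizer_eq_E_mat[OF assms(1)])
  \<comment> \<open>\<open>P\<close> is an element of \<open>E\<close>, where \<open>fls_X\<close>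
    stands for the square root of \<epsilon>; hence odd \<open>j\<close> occur as well.\<close>
  define P :: "'a fls" where "P = fls_X powi j"
  have P: "P \<noteq> 0" "fls_subdegree P = j"
    by (simp_all add: P_def del: fls_X_power_int)
  obtain x0 y0 where P0: "E_elt x0 y0 = P"
    using E_elt_surj by blast
  have "{s \<in> T. fls_subdegree (det s) = j} = E_mat x0 y0 <#\<^bsub>GL2\<^esub> O_E_units"
  proof (intro equalityI subsetI)
    fix s assume "s \<in> {s \<in> T. fls_subdegree (det s) = j}"
    then obtain x y where s: "s = E_mat x y" "E_elt x y \<noteq> 0" "fls_subdegree (E_elt x y) = j"
      by (auto simp: T fls_subdegree_det_E_mat)
    obtain x' y' where e: "E_elt x' y' = E_elt x y / P"
      using E_elt_surj by blast
    then have "E_mat x' y' \<in> O_E_units"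
      using s P unfolding O_E_units_eq
      by (intro CollectI exI[of _ x'] exI[of _ y']) (simp add: fls_divide_subdegree)
    moreover have "E_elt (x0 * x' + fls_X * y0 * y') (x0 * y' + y0 * x') = E_elt x y"
      using P by (simp add: P0 e flip: E_elt_mult)
    then have "s = E_mat x0 y0 ** E_mat x' y'"
      unfolding s(1) E_mat_mult by (auto dest: E_elt_inject)
    ultimately show "s \<in> E_mat x0 y0 <#\<^bsub>GL2\<^esub> O_E_units"
      by (auto simp: l_coset_def)
  next
    fix s assume "s \<in> E_mat x0 y0 <#\<^bsub>GL2\<^esub> O_E_units"
    then obtain x y where xy: "s = E_mat x0 y0 ** E_mat x y" "E_elt x y \<noteq> 0" "fls_subdegree (E_elt x y) = 0"
      by (auto simp: l_coset_def O_E_units_eq)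
    moreover have "E_elt (x0 * x + fls_X * y0 * y) (x0 * y + y0 * x) = P * E_elt x y"
      by (simp add: P0 flip: E_elt_mult)
    ultimately show "s \<in> {s \<in> T. fls_subdegree (det s) = j}"
      using P unfolding T E_mat_mult mem_Collect_eq
      by (intro conjI exI[of _ "x0 * x + fls_X * y0 * y"] exI[of _ "x0 * y + y0 * x"])
        (simp_all add: fls_subdegree_det_E_mat)
  qed
  moreover have "E_mat x0 y0 \<in> T"
    using P P0 by (auto simp: T)
  ultimately show ?thesis by blast
qed

text \<open>Translation by the centralizer is undone by the inverse, which is again in the
  centralizer. Thus the integrand is constant on each nonempty coset, as \<open>quotient_fun\<close>
  demands.\<close>

lemma rcoset_centralizer_integral_conjugators:
  assumes "invertible g"
  shows "h \<in> centralizer \<gamma> #>\<^bsub>GL2\<^esub> g \<Longrightarrow> h \<in> integral_conjugators \<gamma> \<longleftrightarrow> g \<in> integral_conjugators \<gamma>"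
    and "g \<in> centralizer \<gamma> #>\<^bsub>GL2\<^esub> g"
proof -
  show "g \<in> centralizer \<gamma> #>\<^bsub>GL2\<^esub> g"
    using GL2.one_closed by (auto simp: r_coset_def centralizer_def intro!: bexI[of _ "mat 1"])
  assume "h \<in> centralizer \<gamma> #>\<^bsub>GL2\<^esub> g"
  then obtain t where t: "invertible t" "t ** \<gamma> = \<gamma> ** t" "h = t ** g"
    by (auto simp: r_coset_def centralizer_def)
  have "matrix_inv t ** \<gamma> = matrix_inv t ** (\<gamma> ** t) ** matrix_inv t"
    using t(1) by (simp add: matrix_inv_inverse flip: matrix_mul_assoc)
  also have "\<dots> = \<gamma> ** matrix_inv t"
    using t(1) by (simp add: matrix_inv_inverse matrix_mul_assoc flip: t(2))
  finally have "matrix_inv t \<in> centralizer \<gamma>"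
    using t(1) GL2.inv_closed[of t] by (simp add: centralizer_def inv_GL2)
  moreover have "matrix_inv t ** h = g"
    using t(1,3) by (simp add: matrix_inv_inverse matrix_mul_assoc)
  moreover have "t \<in> centralizer \<gamma>"
    using t by (simp add: centralizer_def)
  ultimately show "h \<in> integral_conjugators \<gamma> \<longleftrightarrow> g \<in> integral_conjugators \<gamma>"
    using centralizer_mult_integral_conjugators t(3) by metis
qed

section \<open>Weil's integration formula\<close>

lemma quotient_fun_eqI: "c \<noteq> {} \<Longrightarrow> (\<And>h. h \<in> c \<Longrightarrow> \<phi> h = v) \<Longrightarrow> quotient_fun \<phi> c = v"
proof -
  assume "c \<noteq> {}" "\<And>h. h \<in> c \<Longrightarrow> \<phi> h = v"
  then have "\<phi> ` c = {v}" by auto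
  then show ?thesis by (simp add: quotient_fun_def)
qed

lemma orbital_integral_eq_card_fundamental_domain:
  fixes u :: "'a::finite_field fls"
  assumes "u \<noteq> 0" and \<gamma>: "\<gamma> = mat2 0 u (fls_X * u) 0"
    and fin: "finite (fundamental_domain \<gamma>)"
    and measures: "normalized_measures \<gamma> dg dt M"
  shows "orbital_integral M \<gamma> = real (card (fundamental_domain \<gamma>))"
proof -
  define S where "S = integral_conjugators \<gamma>"
  define S0 where "S0 = {g \<in> S. fls_subdegree (det g) = 0}"
  define T where "T = centralizer \<gamma>"
  define R where "R = {c \<in> rcosets\<^bsub>GL2\<^esub> T. c \<subseteq> S}"
  have haar: "is_haar_measure GL2 dg" "emeasure dg K_O = 1"
    "is_haar_measure (GL2\<lparr>carrier := T\<rparr>) dt" "emeasure dt O_E_units = 1"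
    "is_quotient_measure GL2 T dg dt M"
    using measures by (simp_all add: normalized_measures_def T_def)
  have inv: "invertible g" if "g \<in> S" for g
    using that by (simp add: S_def integral_conjugators_iff)

  have sets_dg: "c \<in> sets dg" and emeasure_dg: "emeasure dg c = 1" if c: "c \<in> fundamental_domain \<gamma>" for c
  proof -
    obtain g where g: "g \<in> S" "c = g <#\<^bsub>GL2\<^esub> K_O"
      using c by (auto simp: fundamental_domain_eq S_def)
    \<comment> \<open>\<open>emeasure\<close> is 0 outside the measurable sets, so measure 1 already
      implies measurability.\<close>
    have "K_O \<in> sets dg"
      using haar(2) by (intro emeasure_neq_0_sets) simp
    then show e: "emeasure dg c = 1"
      using haar(1,2) inv[OF g(1)] by (simp add: is_haar_measure_def g(2))
    show "c \<in> sets dg"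
      using e by (intro emeasure_neq_0_sets) simp
  qed
  have S0: "S0 = \<Union> (fundamental_domain \<gamma>)"
  proof (intro equalityI subsetI)
    fix g assume "g \<in> S0"
    then show "g \<in> \<Union> (fundamental_domain \<gamma>)"
      using GL2.lcos_self[of g K_O] subgroup_K_O inv by (auto simp: fundamental_domain_eq S0_def S_def)
  next
    fix h assume "h \<in> \<Union> (fundamental_domain \<gamma>)"
    then obtain g k where "g \<in> S" "fls_subdegree (det g) = 0" "k \<in> K_O" "h = g ** k"
      by (auto simp: fundamental_domain_eq S_def l_coset_def)
    then show "h \<in> S0"
      using inv by (auto simp: S0_def S_def integral_conjugators_mult_K_O det_mul K_O_iff invertible_det_nz)
  qed
  have "disjoint_family_on (\<lambda>c. c) (fundamental_domain \<gamma>)"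
    unfolding disjoint_family_on_def
  proof (intro ballI impI)
    fix c d assume "c \<in> fundamental_domain \<gamma>" "d \<in> fundamental_domain \<gamma>" "c \<noteq> d"
    moreover have "c \<in> lcosets\<^bsub>GL2\<^esub> K_O" if "c \<in> fundamental_domain \<gamma>" for c
      using that inv by (auto simp: fundamental_domain_eq LCOSETS_def S_def)
    ultimately show "c \<inter> d = {}"
      using GL2.lcos_disjoint[OF subgroup_K_O] by blast
  qed
  moreover have "fundamental_domain \<gamma> \<subseteq> sets dg"
    using sets_dg by blast
  ultimately have "emeasure dg S0 = (\<Sum>c\<in>fundamental_domain \<gamma>. emeasure dg c)"
    unfolding S0 using sum_emeasure[of "\<lambda>c. c" "fundamental_domain \<gamma>" dg] fin by simp
  then have card: "emeasure dg S0 = of_nat (card (fundamental_domain \<gamma>))"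
    by (simp add: emeasure_dg)
  have S0_sets: "S0 \<in> sets dg"
    unfolding S0 using sets_dg fin by (intro sets.finite_Union) auto

  have space_dt: "space dt = T"
    using haar(3) sets_eq_imp_space_eq[of dt "restrict_space borel T"]
    by (simp add: is_haar_measure_def space_restrict_space)
  have inner: "(\<integral>\<^sup>+ t. indicator S0 (t ** g) \<partial>dt) = (indicator S g :: ennreal)" if g: "invertible g" for g
  proof -
    have coset: "t ** g \<in> S \<longleftrightarrow> g \<in> S" if "t \<in> T" for t
      using that rcoset_centralizer_integral_conjugators(1)[OF g, of "t ** g" \<gamma>]
      by (auto simp: S_def T_def r_coset_def)
    \<comment> \<open>For \<open>g\<close> in \<open>S\<close>, the elements \<open>t\<close> of the
      torus that move \<open>g\<close> into \<open>S0\<close> form \<open>C\<close>, a translate of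
      \<open>O_E_units\<close>.\<close>
    define C where "C = {t \<in> T. fls_subdegree (det t) = - fls_subdegree (det g)}"
    obtain t0 where t0: "t0 \<in> T" "C = t0 <#\<^bsub>GL2\<^esub> O_E_units"
      using centralizer_val_det_eq_coset[OF assms(1)] unfolding C_def T_def \<gamma> by blast
    have "O_E_units \<in> sets dt"
      using haar(4) by (intro emeasure_neq_0_sets) simp
    then have "emeasure dt (t0 <#\<^bsub>GL2\<lparr>carrier := T\<rparr>\<^esub> O_E_units) = 1"
      using haar(3,4) t0(1) by (simp add: is_haar_measure_def)
    then have C: "emeasure dt C = 1"
      by (simp add: t0(2) l_coset_def)
    have "(\<integral>\<^sup>+ t. indicator S0 (t ** g) \<partial>dt) = (\<integral>\<^sup>+ t. indicator S g * indicator C t \<partial>dt)"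
    proof (rule nn_integral_cong)
      fix t assume "t \<in> space dt"
      then have t: "t \<in> T" by (simp add: space_dt)
      then have "fls_subdegree (det (t ** g)) = fls_subdegree (det t) + fls_subdegree (det g)"
        using g by (simp add: det_mul T_def centralizer_def invertible_det_nz)
      then show "indicator S0 (t ** g) = (indicator S g * indicator C t :: ennreal)"
        using t coset[OF t] by (auto simp: S0_def C_def indicator_def)
    qed
    also have "\<dots> = indicator S g"
      using C emeasure_neq_0_sets[of dt C] by (simp add: nn_integral_cmult)
    finally show ?thesis .
  qed

  \<comment> \<open>The value type is general because Weil's formula uses \<open>ennreal\<close> and
    the orbital integral uses \<open>real\<close>.\<close>
  have quotient: "quotient_fun \<phi> c = indicator R c"
    if c: "c \<in> rcosets\<^bsub>GL2\<^esub> T" and \<phi>: "\<And>g. invertible g \<Longrightarrow> \<phi> g = indicator S g" for c and \<phi> :: "'a fls^2^2 \<Rightarrow> 'b::zero_neq_one"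
  proof -
    obtain g where g: "invertible g" "c = T #>\<^bsub>GL2\<^esub> g"
      using c by (auto simp: RCOSETS_def)
    have h: "invertible h \<and> (h \<in> S \<longleftrightarrow> g \<in> S)" if "h \<in> c" for h
      using that g rcoset_centralizer_integral_conjugators(1)[OF g(1), of h \<gamma>]
      by (auto simp: S_def T_def r_coset_def centralizer_def invertible_mult)
    have gc: "g \<in> c"
      using rcoset_centralizer_integral_conjugators(2)[OF g(1)] by (simp add: g(2) T_def)
    have "c \<in> R \<longleftrightarrow> g \<in> S"
      using c gc h unfolding R_def by blast
    then have "\<phi> h = indicator R c" if "h \<in> c" for h
      using h[OF that] \<phi>[of h] by (simp add: indicator_def)
    with gc show ?thesis
      by (intro quotient_fun_eqI) auto
  qed
  define Top where "Top = {U. U \<subseteq> rcosets\<^bsub>GL2\<^esub> T \<and> openin (top_of_set (carrier GL2)) (\<Union>U)}"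
  have Top: "Top \<subseteq> Pow (rcosets\<^bsub>GL2\<^esub> T)"
    by (auto simp: Top_def)
  have sets_M: "sets M = sets (sigma (rcosets\<^bsub>GL2\<^esub> T) Top)"
    using haar(5) by (simp add: is_quotient_measure_def Top_def)
  have space_M: "space M = rcosets\<^bsub>GL2\<^esub> T"
    using sets_eq_imp_space_eq[OF sets_M] Top by (simp add: space_measure_of)
  have "\<Union>R = S"
  proof (intro equalityI subsetI)
    fix g assume g: "g \<in> S"
    then have "T #>\<^bsub>GL2\<^esub> g \<in> R"
      using rcoset_centralizer_integral_conjugators(1)[OF inv[OF g], of _ \<gamma>] inv[OF g]
      by (auto simp: R_def S_def T_def RCOSETS_def)
    then show "g \<in> \<Union>R"
      using rcoset_centralizer_integral_conjugators(2)[OF inv[OF g], of \<gamma>] by (auto simp: T_def)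
  qed (auto simp: R_def)
  \<comment> \<open>\<open>R\<close> is open in the quotient topology because its union
    \<open>S\<close> is open in the group.\<close>
  then have "R \<in> Top"
    using openin_integral_conjugators[of \<gamma>] by (auto simp: Top_def R_def S_def)
  then have R: "R \<in> sets M"
    using Top by (simp add: sets_M sets_measure_of)

  have "of_nat (card (fundamental_domain \<gamma>)) = (\<integral>\<^sup>+ g. indicator S0 g \<partial>dg)"
    using S0_sets by (simp add: card)
  also have "\<dots> = (\<integral>\<^sup>+ c. quotient_fun (\<lambda>g. \<integral>\<^sup>+ t. indicator S0 (t \<otimes>\<^bsub>GL2\<^esub> g) \<partial>dt) c \<partial>M)"
    using haar(5) borel_measurable_indicator[OF S0_sets] unfolding is_quotient_measure_def by blast
  also have "\<dots> = (\<integral>\<^sup>+ c. indicator R c \<partial>M)"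
    using inner by (intro nn_integral_cong quotient) (simp_all add: space_M)
  finally have "emeasure M R = of_nat (card (fundamental_domain \<gamma>))"
    using R by simp
  then have "measure M R = card (fundamental_domain \<gamma>)"
    by (simp add: measure_def)
  moreover have "orbital_integral M \<gamma> = (\<integral>c. indicator R c \<partial>M)"
    unfolding orbital_integral_def
    by (intro Bochner_Integration.integral_cong quotient)
      (simp_all add: space_M S_def integral_conjugators_def indicator_def)
  ultimately show ?thesis
    using R by simp
qed

theorem theorem5p2:
  fixes b\<^sub>0 :: "'a::finite_field fps" and n :: nat and \<gamma> :: "'a fls^2^2"
  assumes "CHAR('a) > 2"
    and "b\<^sub>0 dvd 1"
    and "\<gamma> = mat2 0 (fps_to_fls b\<^sub>0 * fls_X ^ n) (fps_to_fls b\<^sub>0 * fls_X ^ (n + 1)) 0"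
  shows "(\<forall>a\<^sub>1 a\<^sub>2. affine_springer_fiber \<gamma> \<inter> iwahori_orbit a\<^sub>1 a\<^sub>2 =
            (if - (int n + 1) \<le> a\<^sub>1 - a\<^sub>2 \<and> a\<^sub>1 - a\<^sub>2 \<le> int n then iwahori_orbit a\<^sub>1 a\<^sub>2 else {})) \<and>
         card (fundamental_domain \<gamma>) = (\<Sum>i=0..n. CARD('a) ^ i) \<and>
         (\<forall>dg dt M. normalized_measures \<gamma> dg dt M \<longrightarrow>
            J_G M \<gamma> = orbital_integral M \<gamma> \<and>
            orbital_integral M \<gamma> = real (card (fundamental_domain \<gamma>)))"
proof -
  \<comment> \<open>Only the valuation of the upper right entry \<open>u\<close> matters below; it
    is \<open>n\<close> because \<open>b\<^sub>0\<close> is a unit.\<close>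
  define u where "u = fps_to_fls b\<^sub>0 * fls_X ^ n"
  have "fps_to_fls b\<^sub>0 \<noteq> 0" "fls_subdegree (fps_to_fls b\<^sub>0) = 0"
    using assms(2) unfolding fps_to_fls_unit_iff by blast+
  then have u: "u \<noteq> 0" "fls_subdegree u = int n"
    by (simp_all add: u_def fls_subdegree_pow)
  have \<gamma>: "\<gamma> = mat2 0 u (fls_X * u) 0"
    by (simp add: assms(3) u_def algebra_simps)
  have "J_G M \<gamma> = orbital_integral M \<gamma>" for M
    by (simp add: weighted_orbital_integral_def orbital_integral_def weight_G_def)
  moreover have "orbital_integral M \<gamma> = real (card (fundamental_domain \<gamma>))"
    if "normalized_measures \<gamma> dg dt M" for dg dt M
    using orbital_integral_eq_card_fundamental_domain[OF u(1) \<gamma> _ that] finite_fundamental_domain[OF u] \<gamma> by simp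
  ultimately show ?thesis
    using affine_springer_fiber_Int_iwahori_orbit[OF u(1)] card_fundamental_domain[OF u] u(2) \<gamma> by auto
qed

end
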